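(* Let $k,n\geq 1$. The real projective space $\mathbb{R}P^{2k}$ has the fixed point property for $n$-valued maps (every $n$-valued map $\mathbb{R}P^{2k}\multimap\mathbb{R}P^{2k}$ has a fixed point). Further, any $n$-valued map of $\mathbb{R}P^{2k}$ has at least $n$ fixed points.
   Context: A multifunction $\phi\colon X\multimap Y$ between topological spaces assigns to each $x\in X$ a non-empty subset $\phi(x)\subset Y$. It is upper semi-continuous if $\phi(x)$ is closed for all $x$ and $\{x\in X\mid \phi(x)\subset V\}$ is open in $X$ for every open $V\subset Y$; lower semi-continuous if $\{x\in X\mid \phi(x)\cap V\neq\varnothing\}$ is open in $X$ for every open $V\subset Y$; continuous if it is both. An $n$-valued map $\phi\colon X\multimap Y$ is a continuous multifunction such that $\phi(x)$ has exactly $n$ elements for every $x\in X$. An $n$-valued map of $X$ is an $n$-valued map $X\multimap X$; a fixed point of it is a point $x\in X$ with $x\in\phi(x)$. *)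

theory Defs
  imports "HOL-Analysis.Analysis"
begin

definition multifunction :: "'a topology \<Rightarrow> 'b topology \<Rightarrow> ('a \<Rightarrow> 'b set) \<Rightarrow> bool" where
  "multifunction X Y \<phi> \<longleftrightarrow> (\<forall>x \<in> topspace X. \<phi> x \<noteq> {} \<and> \<phi> x \<subseteq> topspace Y)"

definition upper_semicontinuous_multi :: "'a topology \<Rightarrow> 'b topology \<Rightarrow> ('a \<Rightarrow> 'b set) \<Rightarrow> bool" where
  "upper_semicontinuous_multi X Y \<phi> \<longleftrightarrow>
     (\<forall>x \<in> topspace X. closedin Y (\<phi> x)) \<and>
     (\<forall>V. openin Y V \<longrightarrow> openin X {x \<in> topspace X. \<phi> x \<subseteq> V})"

definition lower_semicontinuous_multi :: "'a topology \<Rightarrow> 'b topology \<Rightarrow> ('a \<Rightarrow> 'b set) \<Rightarrow> bool" where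
  "lower_semicontinuous_multi X Y \<phi> \<longleftrightarrow>
     (\<forall>V. openin Y V \<longrightarrow> openin X {x \<in> topspace X. \<phi> x \<inter> V \<noteq> {}})"

definition continuous_multifunction :: "'a topology \<Rightarrow> 'b topology \<Rightarrow> ('a \<Rightarrow> 'b set) \<Rightarrow> bool" where
  "continuous_multifunction X Y \<phi> \<longleftrightarrow>
     multifunction X Y \<phi> \<and> upper_semicontinuous_multi X Y \<phi> \<and> lower_semicontinuous_multi X Y \<phi>"

definition n_valued_map :: "nat \<Rightarrow> 'a topology \<Rightarrow> 'b topology \<Rightarrow> ('a \<Rightarrow> 'b set) \<Rightarrow> bool" where
  "n_valued_map n X Y \<phi> \<longleftrightarrow>
     continuous_multifunction X Y \<phi> \<and> (\<forall>x \<in> topspace X. finite (\<phi> x) \<and> card (\<phi> x) = n)"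

definition fixed_points_multi :: "'a topology \<Rightarrow> ('a \<Rightarrow> 'a set) \<Rightarrow> 'a set" where
  "fixed_points_multi X \<phi> = {x \<in> topspace X. x \<in> \<phi> x}"

definition n_valued_fixed_point_property :: "nat \<Rightarrow> 'a topology \<Rightarrow> bool" where
  "n_valued_fixed_point_property n X \<longleftrightarrow>
     (\<forall>\<phi>. n_valued_map n X X \<phi> \<longrightarrow> (\<exists>x. x \<in> fixed_points_multi X \<phi>))"

definition quotient_topology :: "'a topology \<Rightarrow> ('a \<Rightarrow> 'b) \<Rightarrow> 'b topology" where
  "quotient_topology X f =
     topology (\<lambda>U. U \<subseteq> f ` topspace X \<and> openin X {x \<in> topspace X. f x \<in> U})"

lemma istopology_quotient:
  "istopology (\<lambda>U. U \<subseteq> f ` topspace X \<and> openin X {x \<in> topspace X. f x \<in> U})"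
proof -
  have 1: "{x \<in> topspace X. f x \<in> S \<inter> T} =
      {x \<in> topspace X. f x \<in> S} \<inter> {x \<in> topspace X. f x \<in> T}" for S T
    by blast
  have 2: "{x \<in> topspace X. f x \<in> \<Union>\<K>} = (\<Union>K\<in>\<K>. {x \<in> topspace X. f x \<in> K})" for \<K>
    by blast
  show ?thesis
    unfolding istopology_def 1 2 by (intro conjI allI impI openin_Int openin_Union) blast+
qed

lemma openin_quotient_topology:
  "openin (quotient_topology X f) U \<longleftrightarrow>
     U \<subseteq> f ` topspace X \<and> openin X {x \<in> topspace X. f x \<in> U}"
  unfolding quotient_topology_def topology_inverse'[OF istopology_quotient] ..

lemma topspace_quotient_topology: "topspace (quotient_topology X f) = f ` topspace X"
proof (rule subset_antisym)
  show "topspace (quotient_topology X f) \<subseteq> f ` topspace X"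
    using openin_topspace[of "quotient_topology X f"] unfolding openin_quotient_topology
    by (rule conjunct1)
  have "{x \<in> topspace X. f x \<in> f ` topspace X} = topspace X"
    by blast
  then have "openin (quotient_topology X f) (f ` topspace X)"
    unfolding openin_quotient_topology by simp
  then show "f ` topspace X \<subseteq> topspace (quotient_topology X f)"
    by (rule openin_subset)
qed

lemma quotient_map_quotient_topology: "quotient_map X (quotient_topology X f) f"
  unfolding quotient_map_def openin_quotient_topology topspace_quotient_topology by blast

text \<open>
  Real projective \<open>m\<close>-space is the quotient of the unit sphere \<^term>\<open>nsphere m\<close> of Euclidean
  \<open>(m+1)\<close>-space by the antipodal involution; its points are the classes
  \<open>{x, -x}\<close>.
\<close>

definition antipodal_class :: "(nat \<Rightarrow> real) \<Rightarrow> (nat \<Rightarrow> real) set" where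
  "antipodal_class x = {x, \<lambda>i. - x i}"

definition real_projective_space :: "nat \<Rightarrow> (nat \<Rightarrow> real) set topology" where
  "real_projective_space m = quotient_topology (nsphere m) antipodal_class"

end

theory Submission
  imports Defs "HOL-Homology.Brouwer_Degree"
begin

text \<open>
  Let \<open>q\<close> be the projection of the sphere \<open>S\<close> of even dimension \<open>2k\<close> onto projective space, and
  lift an \<open>n\<close>-valued map \<open>\<phi>\<close> to the multifunction \<open>\<psi> x = q\<^sup>-\<^sup>1 (\<phi> (q x))\<close> of \<open>S\<close>. Its values have
  \<open>2n\<close> elements, are closed under the antipodal map, and \<open>x \<in> \<psi> x\<close> holds precisely when \<open>q x\<close> is a
  fixed point of \<open>\<phi>\<close>. So the fixed points of \<open>\<psi>\<close> form antipodal pairs, one for each fixed point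
  of \<open>\<phi>\<close>.

  The graph of \<open>\<psi>\<close> is a \<open>2n\<close>-fold covering of a simply connected space, hence trivial: \<open>\<psi>\<close> is the
  union of \<open>2n\<close> continuous self-maps of \<open>S\<close>, no two of which agree anywhere. Covering spaces do not
  appear explicitly. The points of a value stay a uniform distance apart, so a selection can be
  moved along a homotopy in finitely many small steps, each time passing to the nearest point of the
  next value (\<open>selection_along_homotopy\<close>). This gives selections through any given point
  over each of two opposite hemispheres; they fit together along the equator because it is
  connected (\<open>nsphere_selection\<close>).

  The rest is degree theory. Two self-maps of \<open>S\<close> are homotopic if they are nowhere antipodal to
  each other, and the antipodal map has degree \<open>-1\<close>. Hence a map without fixed points has degree
  \<open>-1\<close>. If \<open>n = 1\<close>, the two selections are \<open>f\<close> and \<open>-f\<close>, of opposite degrees, so one of them has a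
  fixed point. If \<open>n \<ge> 2\<close>, every selection \<open>f\<close> has a companion \<open>g\<close> with \<open>f x \<noteq> g x\<close> and
  \<open>f x \<noteq> -g x\<close> everywhere; then \<open>f\<close> is homotopic to \<open>-g\<close> and to \<open>g\<close>, which forces degree \<open>0\<close>. So
  each of the \<open>2n\<close> selections has a fixed point, and these points are distinct because the
  selections are. Dividing by \<open>2\<close> gives \<open>n\<close> fixed points of \<open>\<phi>\<close>.
\<close>

section \<open>Continuous selections of multifunctions with values of constant finite size\<close>

lemma finite_set_separated:
  fixes F :: "'b::metric_space set"
  assumes "finite F"
  obtains d where "d > 0" "\<And>y z. y \<in> F \<Longrightarrow> z \<in> F \<Longrightarrow> y \<noteq> z \<Longrightarrow> d \<le> dist y z"
proof -
  let ?D = "insert 1 ((\<lambda>(y, z). dist y z) ` {p \<in> F \<times> F. fst p \<noteq> snd p})"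
  have fin: "finite ?D"
    using assms by simp
  show thesis
  proof
    show "Min ?D > 0"
      using fin by (subst Min_gr_iff) auto
    show "Min ?D \<le> dist y z" if "y \<in> F" "z \<in> F" "y \<noteq> z" for y z
      using fin by (rule Min_le) (use that in force)
  qed
qed

locale finite_valued_multimap =
  fixes S :: "'a::metric_space set" and \<psi> :: "'a \<Rightarrow> 'b::metric_space set" and N :: nat
  assumes compact_domain: "compact S"
    and finite_values: "\<And>x. x \<in> S \<Longrightarrow> finite (\<psi> x)"
    and card_values: "\<And>x. x \<in> S \<Longrightarrow> card (\<psi> x) = N"
    and lower_semicontinuous:
      "\<And>V. open V \<Longrightarrow> openin (top_of_set S) {x \<in> S. \<psi> x \<inter> V \<noteq> {}}"
begin

text \<open>
  Put disjoint small balls around the points of the value at \<open>x\<close>. By lower semicontinuity, every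
  nearby value meets each of these balls, and having equally many points it meets each exactly once.
\<close>

lemma values_vary_continuously:
  assumes x: "x \<in> S" and "\<rho> > 0"
  obtains \<eta> where "\<eta> > 0"
    "\<And>x'. x' \<in> S \<Longrightarrow> dist x x' < \<eta> \<Longrightarrow>
       \<exists>f. bij_betw f (\<psi> x) (\<psi> x') \<and> (\<forall>y\<in>\<psi> x. dist y (f y) < \<rho>)"
proof -
  obtain d where "d > 0" and d: "\<And>y z. y \<in> \<psi> x \<Longrightarrow> z \<in> \<psi> x \<Longrightarrow> y \<noteq> z \<Longrightarrow> d \<le> dist y z"
    using finite_set_separated [OF finite_values [OF x]] by blast
  define r where "r = min \<rho> (d / 2)"
  have r: "r > 0" "r \<le> \<rho>" "2 * r \<le> d"
    using \<open>d > 0\<close> \<open>\<rho> > 0\<close> by (auto simp: r_def)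
  define W where "W = S \<inter> (\<Inter>y\<in>\<psi> x. {x' \<in> S. \<psi> x' \<inter> ball y r \<noteq> {}})"
  have "openin (top_of_set S) W"
  proof (cases "\<psi> x = {}")
    case False
    then have "openin (top_of_set S) (\<Inter>y\<in>\<psi> x. {x' \<in> S. \<psi> x' \<inter> ball y r \<noteq> {}})"
      using finite_values [OF x] by (intro openin_Inter) (auto intro: lower_semicontinuous)
    then show ?thesis
      unfolding W_def by (intro openin_Int) auto
  qed (simp add: W_def)
  moreover have "x \<in> W"
    using x r by (auto simp: W_def)
  ultimately obtain \<eta> where "\<eta> > 0" and \<eta>: "\<And>x'. x' \<in> S \<Longrightarrow> dist x' x < \<eta> \<Longrightarrow> x' \<in> W"
    unfolding openin_euclidean_subtopology_iff by metis
  show thesis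
  proof
    show "\<eta> > 0" by fact
    fix x' assume x': "x' \<in> S" "dist x x' < \<eta>"
    then have "\<forall>y\<in>\<psi> x. \<exists>z\<in>\<psi> x'. dist y z < r"
      using \<eta> [of x'] by (force simp: W_def dist_commute)
    then obtain f where f: "\<And>y. y \<in> \<psi> x \<Longrightarrow> f y \<in> \<psi> x' \<and> dist y (f y) < r"
      by metis
    have inj: "inj_on f (\<psi> x)"
    proof (rule inj_onI, rule ccontr)
      fix y z assume yz: "y \<in> \<psi> x" "z \<in> \<psi> x" "f y = f z" "y \<noteq> z"
      have "dist y z \<le> dist y (f y) + dist z (f z)"
        using dist_triangle2 [of y z "f y"] yz(3) by simp
      then show False
        using f [OF yz(1)] f [OF yz(2)] d [OF yz(1,2,4)] r by linarith
    qed
    \<comment> \<open>Constancy of the cardinality is what makes an injection between values onto, so that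
        lower semicontinuity also controls the position of every element of the nearby value.\<close>
    have "f ` \<psi> x = \<psi> x'"
      using f inj x x'
      by (intro card_subset_eq) (auto simp: finite_values card_values card_image)
    then show "\<exists>f. bij_betw f (\<psi> x) (\<psi> x') \<and> (\<forall>y\<in>\<psi> x. dist y (f y) < \<rho>)"
      using inj f r by (intro exI [of _ f]) (force simp: bij_betw_def)
  qed
qed

text \<open>
  By the preceding lemma the minimal distance within a value cannot drop by more than half near a
  given point; compactness makes the local bounds uniform.
\<close>

lemma values_uniformly_separated:
  obtains \<epsilon> where "\<epsilon> > 0"
    "\<And>x y z. x \<in> S \<Longrightarrow> y \<in> \<psi> x \<Longrightarrow> z \<in> \<psi> x \<Longrightarrow> y \<noteq> z \<Longrightarrow> \<epsilon> \<le> dist y z"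
proof -
  have "\<exists>\<eta>>0. \<exists>\<epsilon>>0. \<forall>x'\<in>S. dist x x' < \<eta> \<longrightarrow>
          (\<forall>y\<in>\<psi> x'. \<forall>z\<in>\<psi> x'. y \<noteq> z \<longrightarrow> \<epsilon> \<le> dist y z)" if x: "x \<in> S" for x
  proof -
    obtain d where "d > 0" and d: "\<And>y z. y \<in> \<psi> x \<Longrightarrow> z \<in> \<psi> x \<Longrightarrow> y \<noteq> z \<Longrightarrow> d \<le> dist y z"
      using finite_set_separated [OF finite_values [OF x]] by blast
    then have "d / 4 > 0" by simp
    then obtain \<eta> where "\<eta> > 0" and \<eta>: "\<And>x'. x' \<in> S \<Longrightarrow> dist x x' < \<eta> \<Longrightarrow>
         \<exists>f. bij_betw f (\<psi> x) (\<psi> x') \<and> (\<forall>y\<in>\<psi> x. dist y (f y) < d / 4)"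
      using values_vary_continuously [OF x] by metis
    have "d / 2 \<le> dist y z"
      if x': "x' \<in> S" "dist x x' < \<eta>" and yz: "y \<in> \<psi> x'" "z \<in> \<psi> x'" "y \<noteq> z" for x' y z
    proof -
      obtain f where f: "bij_betw f (\<psi> x) (\<psi> x')" "\<And>y. y \<in> \<psi> x \<Longrightarrow> dist y (f y) < d / 4"
        using \<eta> [OF x'] by blast
      obtain a b where ab: "a \<in> \<psi> x" "b \<in> \<psi> x" "y = f a" "z = f b"
        using yz f(1) by (metis bij_betw_imp_surj_on imageE)
      have "d \<le> dist a b"
        using d ab yz(3) by blast
      also have "\<dots> \<le> dist a (f a) + dist (f a) (f b) + dist b (f b)"
        using dist_triangle [of a b "f a"] dist_triangle [of "f a" b "f b"]
        by (simp add: dist_commute)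
      finally show ?thesis
        using f(2) [OF ab(1)] f(2) [OF ab(2)] unfolding ab(3,4) by linarith
    qed
    then show ?thesis
      using \<open>\<eta> > 0\<close> \<open>d > 0\<close> by (intro exI [of _ \<eta>] conjI exI [of _ "d / 2"]) auto
  qed
  then obtain \<eta> \<epsilon> where \<eta>: "\<And>x. x \<in> S \<Longrightarrow> \<eta> x > 0" and \<epsilon>: "\<And>x. x \<in> S \<Longrightarrow> \<epsilon> x > (0::real)"
    and sep: "\<And>x x' y z. \<lbrakk>x \<in> S; x' \<in> S; dist x x' < \<eta> x; y \<in> \<psi> x'; z \<in> \<psi> x'; y \<noteq> z\<rbrakk>
                \<Longrightarrow> \<epsilon> x \<le> dist y z"
    by metis
  obtain T where T: "T \<subseteq> S" "finite T" "S \<subseteq> (\<Union>x\<in>T. ball x (\<eta> x))"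
  proof (rule compactE_image [OF compact_domain, of S "\<lambda>x. ball x (\<eta> x)"])
    show "S \<subseteq> (\<Union>x\<in>S. ball x (\<eta> x))"
      using \<eta> by force
  qed auto
  show thesis
  proof
    show "Min (insert 1 (\<epsilon> ` T)) > 0"
      using T \<epsilon> by (subst Min_gr_iff) auto
    fix x y z assume x: "x \<in> S" and yz: "y \<in> \<psi> x" "z \<in> \<psi> x" "y \<noteq> z"
    then obtain t where t: "t \<in> T" "dist t x < \<eta> t"
      using T(3) by fastforce
    have "Min (insert 1 (\<epsilon> ` T)) \<le> \<epsilon> t"
      using T t by (intro Min_le) auto
    also have "\<epsilon> t \<le> dist y z"
      using sep [of t x y z] T t x yz by blast
    finally show "Min (insert 1 (\<epsilon> ` T)) \<le> dist y z" .
  qed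
qed

lemma values_vary_uniformly:
  assumes "\<rho> > 0"
  obtains \<delta> where "\<delta> > 0"
    "\<And>x x' y. x \<in> S \<Longrightarrow> x' \<in> S \<Longrightarrow> dist x x' < \<delta> \<Longrightarrow> y \<in> \<psi> x \<Longrightarrow> \<exists>z\<in>\<psi> x'. dist y z < \<rho>"
proof -
  have "\<exists>\<eta>>0. \<forall>x'\<in>S. dist x x' < \<eta> \<longrightarrow>
          (\<exists>f. bij_betw f (\<psi> x) (\<psi> x') \<and> (\<forall>y\<in>\<psi> x. dist y (f y) < \<rho> / 2))" if "x \<in> S" for x
    using values_vary_continuously [OF that, of "\<rho> / 2"] assms by (metis half_gt_zero)
  then obtain \<eta> where \<eta>: "\<And>x. x \<in> S \<Longrightarrow> \<eta> x > 0"
    and near: "\<And>x x'. \<lbrakk>x \<in> S; x' \<in> S; dist x x' < \<eta> x\<rbrakk> \<Longrightarrow>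
                 \<exists>f. bij_betw f (\<psi> x) (\<psi> x') \<and> (\<forall>y\<in>\<psi> x. dist y (f y) < \<rho> / 2)"
    by metis
  obtain \<delta> where "\<delta> > 0" and \<delta>: "\<And>x. x \<in> S \<Longrightarrow> \<exists>G \<in> (\<lambda>x. ball x (\<eta> x)) ` S. ball x \<delta> \<subseteq> G"
  proof (rule Heine_Borel_lemma [OF compact_domain])
    show "S \<subseteq> \<Union>((\<lambda>x. ball x (\<eta> x)) ` S)"
      using \<eta> by force
  qed auto
  show thesis
  proof
    show "\<delta> > 0" by fact
    fix x x' y assume x: "x \<in> S" "x' \<in> S" "dist x x' < \<delta>" and y: "y \<in> \<psi> x"
    obtain c where c: "c \<in> S" "ball x \<delta> \<subseteq> ball c (\<eta> c)"
      using \<delta> [OF x(1)] by blast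
    then have "dist c x < \<eta> c" "dist c x' < \<eta> c"
      using x \<open>\<delta> > 0\<close> by (auto simp: subset_iff)
    then obtain f g where
      f: "bij_betw f (\<psi> c) (\<psi> x)" "\<And>w. w \<in> \<psi> c \<Longrightarrow> dist w (f w) < \<rho> / 2" and
      g: "bij_betw g (\<psi> c) (\<psi> x')" "\<And>w. w \<in> \<psi> c \<Longrightarrow> dist w (g w) < \<rho> / 2"
      using near [OF c(1) x(1)] near [OF c(1) x(2)] by blast
    obtain w where w: "w \<in> \<psi> c" "y = f w"
      using y f(1) by (metis bij_betw_imp_surj_on imageE)
    have "dist y (g w) < \<rho>"
      using dist_triangle_half_r [of w y \<rho> "g w"] f(2) [OF w(1)] g(2) [OF w(1)] w by simp
    then show "\<exists>z\<in>\<psi> x'. dist y z < \<rho>"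
      using g(1) w(1) by (metis bij_betwE)
  qed
qed

text \<open>
  Uniqueness of lifts. The distance between two selections is continuous, but it cannot take values
  strictly between \<open>0\<close> and the separation constant.
\<close>

lemma selections_agree:
  fixes g :: "'c::topological_space \<Rightarrow> 'a"
  assumes "connected C" "g ` C \<subseteq> S"
    and s: "continuous_on C s" "\<And>c. c \<in> C \<Longrightarrow> s c \<in> \<psi> (g c)"
    and t: "continuous_on C t" "\<And>c. c \<in> C \<Longrightarrow> t c \<in> \<psi> (g c)"
    and "a \<in> C" "s a = t a" "c \<in> C"
  shows "s c = t c"
proof (rule ccontr)
  assume "s c \<noteq> t c"
  obtain \<epsilon> where "\<epsilon> > 0"
    and \<epsilon>: "\<And>x y z. x \<in> S \<Longrightarrow> y \<in> \<psi> x \<Longrightarrow> z \<in> \<psi> x \<Longrightarrow> y \<noteq> z \<Longrightarrow> \<epsilon> \<le> dist y z"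
    using values_uniformly_separated by blast
  let ?d = "\<lambda>c. dist (s c) (t c)"
  have far: "?d z = 0 \<or> \<epsilon> \<le> ?d z" if "z \<in> C" for z
    using \<epsilon> [of "g z" "s z" "t z"] assms that by auto
  have "connected (?d ` C)"
    using assms by (intro connected_continuous_image continuous_intros) auto
  moreover have "0 \<in> ?d ` C" "?d c \<in> ?d ` C"
    using assms by (auto simp: image_iff intro: bexI [of _ a])
  moreover have "0 \<le> \<epsilon> / 2" "\<epsilon> / 2 \<le> ?d c"
    using far [of c] \<open>s c \<noteq> t c\<close> \<open>\<epsilon> > 0\<close> assms by auto
  ultimately have "\<epsilon> / 2 \<in> ?d ` C"
    using connectedD_interval [of "?d ` C" 0 "?d c" "\<epsilon> / 2"] by blast
  then show False
    using far \<open>\<epsilon> > 0\<close> by fastforce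
qed

text \<open>
  One step of the lifting process, from a selection over \<open>g\<close> to one over a nearby map \<open>g'\<close>. The new
  selection takes the point of the new value closest to the old one; the separation \<open>2 * \<epsilon>\<close> makes
  this choice unique and therefore continuous. The last conclusion, that nothing moves where the
  old selection is still valid, is needed to control starting points in \<open>homotopy_lifting\<close>.
\<close>

lemma transport_selection:
  fixes g g' :: "'c::metric_space \<Rightarrow> 'a" and s :: "'c \<Rightarrow> 'b"
  assumes \<epsilon>: "\<And>x y z. x \<in> S \<Longrightarrow> y \<in> \<psi> x \<Longrightarrow> z \<in> \<psi> x \<Longrightarrow> y \<noteq> z \<Longrightarrow> 2 * \<epsilon> \<le> dist y z"
    and near: "\<And>b. b \<in> B \<Longrightarrow> \<exists>z\<in>\<psi> (g' b). dist (s b) z < \<epsilon>"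
    and g': "continuous_on B g'" "g' ` B \<subseteq> S"
    and s: "continuous_on B s"
  obtains s' where "continuous_on B s'" "\<And>b. b \<in> B \<Longrightarrow> s' b \<in> \<psi> (g' b)"
    "\<And>b. b \<in> B \<Longrightarrow> s b \<in> \<psi> (g' b) \<Longrightarrow> s' b = s b"
proof -
  obtain s' where s': "\<And>b. b \<in> B \<Longrightarrow> s' b \<in> \<psi> (g' b) \<and> dist (s b) (s' b) < \<epsilon>"
    using near by metis
  have "continuous_on B s'"
    unfolding continuous_on_iff
  proof (intro ballI allI impI)
    fix b and e :: real assume b: "b \<in> B" and "e > 0"
    define \<eta> where "\<eta> = min e ((\<epsilon> - dist (s b) (s' b)) / 2)"
    have \<eta>: "\<eta> > 0" "\<eta> \<le> e" "dist (s b) (s' b) + 2 * \<eta> \<le> \<epsilon>"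
      using s' [OF b] \<open>e > 0\<close> by (auto simp: \<eta>_def min_def field_simps)
    obtain d1 where "d1 > 0" and d1: "\<And>c. c \<in> B \<Longrightarrow> dist c b < d1 \<Longrightarrow> dist (s c) (s b) < \<eta>"
      using s b \<eta>(1) unfolding continuous_on_iff by metis
    define W where "W = {x \<in> S. \<psi> x \<inter> ball (s' b) \<eta> \<noteq> {}}"
    have "openin (top_of_set S) W"
      unfolding W_def by (intro lower_semicontinuous) auto
    then have "openin (top_of_set B) (B \<inter> g' -` W)"
      using g' by (intro continuous_openin_preimage [of B g' S]) auto
    moreover have "b \<in> B \<inter> g' -` W"
      using b g' s' [OF b] \<eta> by (auto simp: W_def)
    ultimately obtain d2 where "d2 > 0"
      and d2: "\<forall>c\<in>B. dist c b < d2 \<longrightarrow> c \<in> B \<inter> g' -` W"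
      unfolding openin_euclidean_subtopology_iff by blast
    have "dist (s' c) (s' b) < e" if c: "c \<in> B" "dist c b < min d1 d2" for c
    proof -
      have "g' c \<in> W"
        using d2 c by auto
      then obtain z where z: "z \<in> \<psi> (g' c)" "dist (s' b) z < \<eta>"
        by (auto simp: W_def)
      have "dist (s c) z \<le> dist (s c) (s b) + dist (s b) (s' b) + dist (s' b) z"
        using dist_triangle [of "s c" z "s b"] dist_triangle [of "s b" z "s' b"] by simp
      also have "\<dots> < \<epsilon>"
        using d1 [OF c(1)] c(2) z(2) \<eta>(3) by simp
      finally have "dist (s c) z < \<epsilon>" .
      then have "dist z (s' c) < 2 * \<epsilon>"
        using s' [OF c(1)] dist_triangle [of z "s' c" "s c"] by (simp add: dist_commute)
      then have "z = s' c"
        using \<epsilon> [of "g' c" z "s' c"] z(1) s' [OF c(1)] g' c(1) by force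
      then show ?thesis
        using z(2) \<eta>(2) by (simp add: dist_commute)
    qed
    then show "\<exists>d>0. \<forall>c\<in>B. dist c b < d \<longrightarrow> dist (s' c) (s' b) < e"
      using \<open>d1 > 0\<close> \<open>d2 > 0\<close> by (intro exI [of _ "min d1 d2"]) auto
  qed
  moreover have "s' b = s b" if b: "b \<in> B" "s b \<in> \<psi> (g' b)" for b
  proof (rule ccontr)
    assume "s' b \<noteq> s b"
    then have "2 * \<epsilon> \<le> dist (s b) (s' b)"
      using b s' g'(2) by (intro \<epsilon> [of "g' b"]) auto
    then show False
      using s' [OF b(1)] zero_le_dist [of "s b" "s' b"] by linarith
  qed
  ultimately show thesis
    using that s' by blast
qed

text \<open>
  By uniform continuity of \<open>H\<close>, the unit interval can be cut into \<open>m\<close> steps so short that on each of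
  them every point of a value has a point of the next value within half the separation constant.
\<close>

lemma selection_along_homotopy:
  fixes H :: "real \<times> 'c::metric_space \<Rightarrow> 'a"
  assumes "compact B" and H: "continuous_on ({0..1} \<times> B) H" "H ` ({0..1} \<times> B) \<subseteq> S"
    and s0: "continuous_on B s0" "\<And>b. b \<in> B \<Longrightarrow> s0 b \<in> \<psi> (H (0, b))"
  obtains s where "continuous_on B s" "\<And>b. b \<in> B \<Longrightarrow> s b \<in> \<psi> (H (1, b))"
    "\<And>b. b \<in> B \<Longrightarrow> (\<And>t. t \<in> {0..1} \<Longrightarrow> H (t, b) = H (0, b)) \<Longrightarrow> s b = s0 b"
proof -
  obtain \<epsilon> where "\<epsilon> > 0"
    and \<epsilon>: "\<And>x y z. x \<in> S \<Longrightarrow> y \<in> \<psi> x \<Longrightarrow> z \<in> \<psi> x \<Longrightarrow> y \<noteq> z \<Longrightarrow> \<epsilon> \<le> dist y z"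
    using values_uniformly_separated by blast
  obtain \<delta> where "\<delta> > 0" and \<delta>: "\<And>x x' y. x \<in> S \<Longrightarrow> x' \<in> S \<Longrightarrow> dist x x' < \<delta> \<Longrightarrow> y \<in> \<psi> x
      \<Longrightarrow> \<exists>z\<in>\<psi> x'. dist y z < \<epsilon> / 2"
    using values_vary_uniformly [of "\<epsilon> / 2"] \<open>\<epsilon> > 0\<close> by (metis half_gt_zero)
  have "uniformly_continuous_on ({0..1} \<times> B) H"
    using H(1) \<open>compact B\<close> by (intro compact_uniformly_continuous compact_Times) auto
  then obtain \<eta> where "\<eta> > 0" and \<eta>: "\<And>p q. \<lbrakk>p \<in> {0..1} \<times> B; q \<in> {0..1} \<times> B; dist q p < \<eta>\<rbrakk>
      \<Longrightarrow> dist (H q) (H p) < \<delta>"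
    using \<open>\<delta> > 0\<close> unfolding uniformly_continuous_on_def by metis
  obtain m :: nat where m: "m > 0" "1 / real m < \<eta>"
    using \<open>\<eta> > 0\<close> by (metis nat_approx_posE zero_less_Suc)
  have "\<exists>s. continuous_on B s \<and> (\<forall>b\<in>B. s b \<in> \<psi> (H (real i / real m, b))) \<and>
           (\<forall>b\<in>B. (\<forall>t\<in>{0..1}. H (t, b) = H (0, b)) \<longrightarrow> s b = s0 b)" if "i \<le> m" for i
    using that
  proof (induction i)
    case 0
    then show ?case
      using s0 by auto
  next
    case (Suc i)
    then obtain s where s: "continuous_on B s" "\<And>b. b \<in> B \<Longrightarrow> s b \<in> \<psi> (H (real i / real m, b))"
      and stay: "\<And>b. b \<in> B \<Longrightarrow> \<forall>t\<in>{0..1}. H (t, b) = H (0, b) \<Longrightarrow> s b = s0 b"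
      by auto
    let ?t = "real i / real m" and ?t' = "real (Suc i) / real m"
    have t: "?t \<in> {0..1}" "?t' \<in> {0..1}"
      using Suc.prems m by auto
    have "?t' - ?t = 1 / real m"
      by (simp add: diff_divide_distrib [symmetric])
    then have step: "dist ?t' ?t < \<eta>"
      using m unfolding dist_real_def by simp
    have HS: "H (u, b) \<in> S" if "u \<in> {0..1}" "b \<in> B" for u b
      using H(2) that by blast
    obtain s' where "continuous_on B s'" "\<And>b. b \<in> B \<Longrightarrow> s' b \<in> \<psi> (H (?t', b))"
      and stay': "\<And>b. b \<in> B \<Longrightarrow> s b \<in> \<psi> (H (?t', b)) \<Longrightarrow> s' b = s b"
    proof (rule transport_selection [of "\<epsilon> / 2" B "\<lambda>b. H (?t', b)" s])
      show "\<exists>z\<in>\<psi> (H (?t', b)). dist (s b) z < \<epsilon> / 2" if "b \<in> B" for b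
      proof (rule \<delta>)
        show "dist (H (?t, b)) (H (?t', b)) < \<delta>"
          using t that step by (intro \<eta>) (auto simp: dist_Pair_Pair dist_commute)
      qed (use HS t s that in auto)
      show "continuous_on B (\<lambda>b. H (?t', b))"
        using t by (intro continuous_on_compose2 [OF H(1)] continuous_intros) auto
      show "(\<lambda>b. H (?t', b)) ` B \<subseteq> S"
        using HS t by blast
    qed (use \<epsilon> s in auto)
    moreover have "s' b = s0 b" if "b \<in> B" "\<forall>t\<in>{0..1}. H (t, b) = H (0, b)" for b
      using stay [OF that] stay' [OF that(1)] s0(2) [OF that(1)] that(2) t(2) by metis
    ultimately show ?case
      by blast
  qed
  from this [of m] obtain s where "continuous_on B s" "\<forall>b\<in>B. s b \<in> \<psi> (H (1, b))"
    "\<forall>b\<in>B. (\<forall>t\<in>{0..1}. H (t, b) = H (0, b)) \<longrightarrow> s b = s0 b"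
    using m by auto
  then show thesis
    using that by blast
qed

text \<open>
  The homotopy lifting property, obtained by transporting \<open>s0\<close> along \<open>(u, t, b) \<mapsto> H (u * t, b)\<close>. This
  homotopy ends at \<open>H\<close> itself, and it is stationary over \<open>t = 0\<close>, so that the lift starts at \<open>s0\<close>.
\<close>

lemma homotopy_lifting:
  fixes H :: "real \<times> 'c::metric_space \<Rightarrow> 'a"
  assumes "compact B" and H: "continuous_on ({0..1} \<times> B) H" "H ` ({0..1} \<times> B) \<subseteq> S"
    and s0: "continuous_on B s0" "\<And>b. b \<in> B \<Longrightarrow> s0 b \<in> \<psi> (H (0, b))"
  obtains L where "continuous_on ({0..1} \<times> B) L"
    "\<And>t b. t \<in> {0..1} \<Longrightarrow> b \<in> B \<Longrightarrow> L (t, b) \<in> \<psi> (H (t, b))"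
    "\<And>b. b \<in> B \<Longrightarrow> L (0, b) = s0 b"
proof -
  let ?K = "\<lambda>(u, t, b). H (u * t, b)"
  have unit: "u * t \<in> {0..1}" if "u \<in> {0..1}" "t \<in> {0..1}" for u t :: real
    using that by (auto intro: mult_le_one)
  obtain L where "continuous_on ({0..1} \<times> B) L"
    and L: "\<And>p. p \<in> {0..1} \<times> B \<Longrightarrow> L p \<in> \<psi> (?K (1, p))"
    and stay: "\<And>p. p \<in> {0..1} \<times> B \<Longrightarrow> (\<And>u. u \<in> {0..1} \<Longrightarrow> ?K (u, p) = ?K (0, p)) \<Longrightarrow> L p = s0 (snd p)"
  proof (rule selection_along_homotopy [of "{0..1} \<times> B" ?K "s0 \<circ> snd"])
    show "compact ({0..1::real} \<times> B)"
      using \<open>compact B\<close> by (intro compact_Times) auto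
    show "continuous_on ({0..1} \<times> {0..1} \<times> B) ?K"
      unfolding case_prod_unfold
      by (intro continuous_on_compose2 [OF H(1)] continuous_intros)
         (use unit in \<open>auto simp del: atLeastAtMost_iff\<close>)
    show "?K ` ({0..1} \<times> {0..1} \<times> B) \<subseteq> S"
      using H(2) unit by (auto simp del: atLeastAtMost_iff)
    show "continuous_on ({0..1} \<times> B) (s0 \<circ> snd)"
      by (intro continuous_on_compose continuous_on_subset [OF s0(1)] continuous_intros) auto
    show "(s0 \<circ> snd) p \<in> \<psi> (?K (0, p))" if "p \<in> {0..1} \<times> B" for p
      using s0(2) that by auto
  qed auto
  moreover have "L (t, b) \<in> \<psi> (H (t, b))" if "t \<in> {0..1}" "b \<in> B" for t b
    using L [of "(t, b)"] that by simp
  moreover have "L (0, b) = s0 b" if "b \<in> B" for b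
    using stay [of "(0, b)"] that by simp
  ultimately show thesis
    using that by blast
qed

text \<open>
  Let \<open>H\<close> expand a point \<open>p\<close> to \<open>A\<close>. Going backwards along the track of \<open>a\<close> carries \<open>y\<close> to some point
  of the value at \<open>p\<close>; lifting \<open>H\<close> from that point gives a selection over \<open>A\<close>, which by uniqueness
  of lifts along the track of \<open>a\<close> returns to \<open>y\<close>.
\<close>

lemma selection_on_contractible:
  assumes "A \<subseteq> S" "compact A" "contractible A" and a: "a \<in> A" "y \<in> \<psi> a"
  obtains s where "continuous_on A s" "\<And>x. x \<in> A \<Longrightarrow> s x \<in> \<psi> x" "s a = y"
proof -
  obtain p where "homotopic_with_canon (\<lambda>x. True) A A (\<lambda>x. p) id"
    using \<open>contractible A\<close> unfolding contractible_def by (auto dest: homotopic_with_symD)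
  then obtain H :: "real \<times> 'a \<Rightarrow> 'a" where H: "continuous_on ({0..1} \<times> A) H" "H ` ({0..1} \<times> A) \<subseteq> A"
    and H0: "\<And>x. H (0, x) = p" and H1: "\<And>x. H (1, x) = x"
    unfolding homotopic_with_def by (auto simp: image_subset_iff_funcset)
  have HS: "H ` ({0..1} \<times> A) \<subseteq> S"
    using H(2) assms(1) by blast
  let ?\<gamma> = "\<lambda>(t, x). H (1 - t, x)"
  have \<gamma>: "continuous_on ({0..1} \<times> {a}) ?\<gamma>"
    unfolding case_prod_unfold
    by (intro continuous_on_compose2 [OF H(1)] continuous_intros) (use a in auto)
  have \<gamma>S: "?\<gamma> ` ({0..1} \<times> {a}) \<subseteq> S"
    using HS a by auto
  obtain P where P: "continuous_on ({0..1} \<times> {a}) P"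
    "\<And>t b. t \<in> {0..1} \<Longrightarrow> b \<in> {a} \<Longrightarrow> P (t, b) \<in> \<psi> (?\<gamma> (t, b))"
    "\<And>b. b \<in> {a} \<Longrightarrow> P (0, b) = y"
    by (rule homotopy_lifting [OF _ \<gamma> \<gamma>S, of "\<lambda>x. y"]) (use a H1 in \<open>auto simp del: atLeastAtMost_iff\<close>)
  have P\<psi>: "P (t, a) \<in> \<psi> (H (1 - t, a))" if "t \<in> {0..1}" for t
    using P(2) [OF that] by simp
  obtain L where L: "continuous_on ({0..1} \<times> A) L"
    "\<And>t x. t \<in> {0..1} \<Longrightarrow> x \<in> A \<Longrightarrow> L (t, x) \<in> \<psi> (H (t, x))"
    "\<And>x. x \<in> A \<Longrightarrow> L (0, x) = P (1, a)"
    using homotopy_lifting [OF \<open>compact A\<close> H(1) HS, of "\<lambda>x. P (1, a)"] P\<psi> [of 1] H0 by auto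
  have "L (1, a) = P (1 - 1, a)"
  proof (rule selections_agree [where C = "{0..1}" and a = 0 and c = 1 and
        g = "\<lambda>t. H (t, a)" and s = "\<lambda>t. L (t, a)" and t = "\<lambda>t. P (1 - t, a)"])
    show "continuous_on {0..1} (\<lambda>t. L (t, a))"
      by (intro continuous_on_compose2 [OF L(1)] continuous_intros) (use a in auto)
    show "continuous_on {0..1} (\<lambda>t. P (1 - t, a))"
      by (intro continuous_on_compose2 [OF P(1)] continuous_intros) auto
    show "(\<lambda>t. H (t, a)) ` {0..1} \<subseteq> S"
      using HS a by auto
    show "P (1 - t, a) \<in> \<psi> (H (t, a))" if "t \<in> {0..1}" for t
      using P\<psi> [of "1 - t"] that by auto
  qed (use L a in auto)
  moreover have "continuous_on A (\<lambda>x. L (1, x))"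
    by (intro continuous_on_compose2 [OF L(1)] continuous_intros) auto
  moreover have "L (1, x) \<in> \<psi> x" if "x \<in> A" for x
    using L(2) [of 1 x] that H1 by auto
  ultimately show thesis
    using that P(3) [of a] by simp
qed

lemma selection_on_union:
  assumes S: "S = A \<union> B" and A: "closed A" "contractible A" and B: "closed B" "contractible B"
    and "connected (A \<inter> B)" and a: "a \<in> A \<inter> B" "y \<in> \<psi> a"
  obtains s where "continuous_on S s" "\<And>x. x \<in> S \<Longrightarrow> s x \<in> \<psi> x" "s a = y"
proof -
  have "compact A" "compact B"
    using compact_Int_closed [OF compact_domain A(1)] compact_Int_closed [OF compact_domain B(1)]
    by (simp_all add: S Int_absorb1)
  obtain f where f: "continuous_on A f" "\<And>x. x \<in> A \<Longrightarrow> f x \<in> \<psi> x" "f a = y"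
    by (rule selection_on_contractible [of A a y]) (use \<open>compact A\<close> A a S in auto)
  obtain g where g: "continuous_on B g" "\<And>x. x \<in> B \<Longrightarrow> g x \<in> \<psi> x" "g a = y"
    by (rule selection_on_contractible [of B a y]) (use \<open>compact B\<close> B a S in auto)
  have agree: "f x = g x" if "x \<in> A \<inter> B" for x
  proof (rule selections_agree [where C = "A \<inter> B" and g = id and a = a])
    show "continuous_on (A \<inter> B) f" "continuous_on (A \<inter> B) g"
      using f g by (auto intro: continuous_on_subset)
  qed (use assms f g that in auto)
  show thesis
  proof
    show "continuous_on S (\<lambda>x. if x \<in> A then f x else g x)"
      unfolding S using A B f g agree by (intro continuous_on_cases) auto
  qed (use S f g a in auto)
qed

end


section \<open>Degrees of self-maps of spheres\<close>

definition antipode :: "(nat \<Rightarrow> real) \<Rightarrow> nat \<Rightarrow> real" where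
  "antipode x = (\<lambda>i. - x i)"

lemma antipode_antipode [simp]: "antipode (antipode x) = x"
  by (simp add: antipode_def)

lemma topspace_nsphere: "topspace (nsphere p) = {x. (\<Sum>i\<le>p. (x i)\<^sup>2) = 1 \<and> (\<forall>i>p. x i = 0)}"
  by (simp add: nsphere)

lemma nsphere_eq_top_of_set: "nsphere p = top_of_set (topspace (nsphere p))"
  by (simp add: nsphere euclidean_product_topology)

lemma continuous_map_nsphere_iff:
  "continuous_map (nsphere p) (nsphere p) f \<longleftrightarrow>
     continuous_on (topspace (nsphere p)) f \<and> f \<in> topspace (nsphere p) \<rightarrow> topspace (nsphere p)"
  by (subst (1 2) nsphere_eq_top_of_set) auto

lemma continuous_map_into_nsphere:
  assumes "\<And>i. continuous_map X euclideanreal (\<lambda>x. f x i)"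
    and "\<And>x. x \<in> topspace X \<Longrightarrow> f x \<in> topspace (nsphere p)"
  shows "continuous_map X (nsphere p) f"
  using assms by (auto simp: nsphere continuous_map_in_subtopology continuous_map_componentwise_UNIV)

lemma antipode_in_nsphere [simp]: "antipode x \<in> topspace (nsphere p) \<longleftrightarrow> x \<in> topspace (nsphere p)"
  by (simp add: topspace_nsphere antipode_def)

lemma antipode_neq: "x \<in> topspace (nsphere p) \<Longrightarrow> antipode x \<noteq> x"
  by (cases "\<forall>i. x i = 0") (auto simp: topspace_nsphere antipode_def fun_eq_iff)

lemma continuous_map_antipode: "continuous_map (nsphere p) (nsphere p) antipode"
  by (rule continuous_map_into_nsphere)
     (simp_all add: antipode_def continuous_map_nsphere_projection topspace_nsphere continuous_map_minus)

text \<open>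
  The segment from \<open>f x\<close> to \<open>g x\<close> passes through the origin only if \<open>f x\<close> and \<open>g x\<close> are
  antipodal; otherwise it can be projected radially to the sphere.
\<close>

lemma homotopic_nsphere_maps:
  assumes f: "continuous_map (nsphere p) (nsphere p) f"
    and g: "continuous_map (nsphere p) (nsphere p) g"
    and neq: "\<And>x. x \<in> topspace (nsphere p) \<Longrightarrow> f x \<noteq> antipode (g x)"
  shows "homotopic_with (\<lambda>x. True) (nsphere p) (nsphere p) f g"
proof -
  let ?S = "topspace (nsphere p)"
  let ?X = "prod_topology (top_of_set {0..1::real}) (nsphere p)"
  define u where "u = (\<lambda>(t::real, x) i. (1 - t) * f x i + t * g x i)"
  define r where "r = (\<lambda>z. sqrt (\<Sum>j\<le>p. (u z j)\<^sup>2))"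
  define h where "h = (\<lambda>z i. u z i / r z)"
  have im: "f x \<in> ?S" "g x \<in> ?S" if "x \<in> ?S" for x
    using f g that by (auto simp: continuous_map_def)
  have contu: "continuous_map ?X euclideanreal (\<lambda>z. u z i)" for i
  proof -
    have "continuous_map ?X euclideanreal (\<lambda>z. f (snd z) i)"
         "continuous_map ?X euclideanreal (\<lambda>z. g (snd z) i)"
      using continuous_map_compose [OF continuous_map_compose [OF continuous_map_snd f]
              continuous_map_nsphere_projection [of p i]]
            continuous_map_compose [OF continuous_map_compose [OF continuous_map_snd g]
              continuous_map_nsphere_projection [of p i]]
      by (simp_all add: o_def)
    moreover have "continuous_map ?X euclideanreal fst"
      by (rule continuous_map_into_fulltopology [OF continuous_map_fst])
    ultimately show ?thesis
      unfolding u_def case_prod_unfold by (intro continuous_intros) auto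
  qed
  have nonzero: "r z \<noteq> 0" if z: "z \<in> topspace ?X" for z
  proof
    assume "r z = 0"
    obtain t x where [simp]: "z = (t, x)" by (cases z)
    have t: "t \<in> {0..1}" and x: "x \<in> ?S" using z by auto
    have u0: "(1 - t) * f x i = - (t * g x i)" if "i \<le> p" for i
      using \<open>r z = 0\<close> that by (auto simp: r_def u_def sum_nonneg_eq_0_iff add_eq_0_iff)
    have "(1 - t)\<^sup>2 = (\<Sum>i\<le>p. ((1 - t) * f x i)\<^sup>2)"
      using im(1) [OF x] by (simp add: topspace_nsphere power_mult_distrib flip: sum_distrib_left)
    also have "\<dots> = (\<Sum>i\<le>p. (t * g x i)\<^sup>2)"
      using u0 by simp
    also have "\<dots> = t\<^sup>2"
      using im(2) [OF x] by (simp add: topspace_nsphere power_mult_distrib flip: sum_distrib_left)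
    finally have "t = 1 / 2"
      by (simp add: power2_eq_square algebra_simps)
    have "f x i = antipode (g x) i" for i
    proof (cases "i \<le> p")
      case True
      then show ?thesis using u0 [OF True] \<open>t = 1 / 2\<close> by (simp add: antipode_def)
    next
      case False
      then show ?thesis using im [OF x] by (simp add: topspace_nsphere antipode_def)
    qed
    then show False using neq [OF x] by blast
  qed
  have "continuous_map ?X (nsphere p) h"
  proof (rule continuous_map_into_nsphere)
    show "continuous_map ?X euclideanreal (\<lambda>z. h z i)" for i
      unfolding h_def using nonzero
      by (intro continuous_map_real_divide contu)
         (auto simp: r_def intro!: continuous_intros contu)
    show "h z \<in> ?S" if z: "z \<in> topspace ?X" for z
    proof -
      have "u z i = 0" if "i > p" for i
        using z im that by (auto simp: u_def topspace_nsphere)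
      moreover have "(\<Sum>i\<le>p. (u z i)\<^sup>2) = (r z)\<^sup>2"
        by (simp add: r_def sum_nonneg)
      ultimately show ?thesis
        using nonzero [OF z]
        by (simp add: topspace_nsphere h_def power_divide flip: sum_divide_distrib)
    qed
  qed
  moreover have "h (0, x) = f x" "h (1, x) = g x" if "x \<in> ?S" for x
    using im [OF that] by (simp_all add: h_def r_def u_def topspace_nsphere)
  ultimately show ?thesis
    by (auto simp: homotopic_with)
qed

definition reflection :: "nat \<Rightarrow> (nat \<Rightarrow> real) \<Rightarrow> nat \<Rightarrow> real" where
  "reflection k x = (\<lambda>i. if i = k then - x i else x i)"

lemma continuous_map_reflection: "continuous_map (nsphere p) (nsphere p) (reflection k)"
  using continuous_map_nsphere_reflection [of p k] by (simp add: reflection_def [abs_def])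

text \<open>
  Exchanging coordinates \<open>0\<close> and \<open>k\<close> conjugates this reflection to the one in coordinate \<open>0\<close>.
\<close>

lemma Brouwer_degree2_reflection_any:
  assumes "k \<le> p"
  shows "Brouwer_degree2 p (reflection k) = -1"
proof -
  define \<tau> :: "(nat \<Rightarrow> real) \<Rightarrow> nat \<Rightarrow> real" where "\<tau> = (\<lambda>x i. x (Transposition.transpose 0 k i))"
  have perm: "Transposition.transpose 0 k permutes {..p}"
    using assms by (intro permutes_swap_id) auto
  have "(\<Sum>i\<le>p. (x (Transposition.transpose 0 k i))\<^sup>2) = (\<Sum>i\<le>p. (x i)\<^sup>2)" for x :: "nat \<Rightarrow> real"
    using sum.permute [OF perm, of "\<lambda>i. (x i)\<^sup>2"] by (simp add: o_def)
  then have cont: "continuous_map (nsphere p) (nsphere p) \<tau>"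
    using perm assms
    by (intro continuous_map_into_nsphere)
       (auto simp: \<tau>_def continuous_map_nsphere_projection topspace_nsphere permutes_def)
  have "\<tau> \<circ> \<tau> = id"
    by (auto simp: \<tau>_def fun_eq_iff)
  then have deg_\<tau>: "Brouwer_degree2 p \<tau> * Brouwer_degree2 p \<tau> = 1"
    using Brouwer_degree2_compose [OF cont cont] by simp
  have "reflection k = \<tau> \<circ> (reflection 0 \<circ> \<tau>)"
    by (auto simp: \<tau>_def reflection_def fun_eq_iff Transposition.transpose_def)
  then have "Brouwer_degree2 p (reflection k) =
      Brouwer_degree2 p \<tau> * (Brouwer_degree2 p (reflection 0) * Brouwer_degree2 p \<tau>)"
    using cont continuous_map_reflection [of p 0]
    by (simp add: Brouwer_degree2_compose continuous_map_compose)
  also have "Brouwer_degree2 p (reflection 0) = -1"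
    using Brouwer_degree2_reflection by (simp add: reflection_def [abs_def])
  finally show ?thesis
    using deg_\<tau> by simp
qed

text \<open>The antipodal map is the composition of the reflections in all \<open>p + 1\<close> coordinates.\<close>

lemma Brouwer_degree2_antipode: "Brouwer_degree2 p antipode = (-1) ^ Suc p"
proof -
  define flip :: "nat \<Rightarrow> (nat \<Rightarrow> real) \<Rightarrow> nat \<Rightarrow> real" where "flip = (\<lambda>m x i. if i < m then - x i else x i)"
  have "continuous_map (nsphere p) (nsphere p) (flip m) \<and> Brouwer_degree2 p (flip m) = (-1) ^ m"
    if "m \<le> Suc p" for m
    using that
  proof (induction m)
    case 0
    have "flip 0 = id"
      by (simp add: flip_def fun_eq_iff)
    then show ?case
      by (simp only: Brouwer_degree2_id continuous_map_id power_0 simp_thms)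
  next
    case (Suc m)
    have eq: "flip (Suc m) = reflection m \<circ> flip m"
      by (auto simp: flip_def reflection_def fun_eq_iff)
    have cont: "continuous_map (nsphere p) (nsphere p) (flip m)"
      using Suc by simp
    show ?case
      unfolding eq Brouwer_degree2_compose [OF cont continuous_map_reflection]
      using Suc by (intro conjI continuous_map_compose [OF cont continuous_map_reflection])
        (simp add: Brouwer_degree2_reflection_any)
  qed
  then have "Brouwer_degree2 p (flip (Suc p)) = (-1) ^ Suc p"
    by blast
  moreover have "flip (Suc p) x = antipode x" if "x \<in> topspace (nsphere p)" for x
    using that by (auto simp: flip_def antipode_def topspace_nsphere fun_eq_iff)
  ultimately show ?thesis
    by (metis Brouwer_degree2_eq)
qed

text \<open>Without fixed points, \<open>f\<close> is nowhere antipodal to the antipodal map, hence homotopic to it.\<close>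

lemma fixed_point_if_degree_neq:
  assumes f: "continuous_map (nsphere p) (nsphere p) f"
    and deg: "Brouwer_degree2 p f \<noteq> (-1) ^ Suc p"
  obtains x where "x \<in> topspace (nsphere p)" "f x = x"
proof (rule ccontr)
  assume "\<not> thesis"
  then have "homotopic_with (\<lambda>x. True) (nsphere p) (nsphere p) f antipode"
    using that by (intro homotopic_nsphere_maps f continuous_map_antipode) auto
  then show False
    using deg Brouwer_degree2_homotopic Brouwer_degree2_antipode by metis
qed

text \<open>
  Under these hypotheses \<open>f\<close> is homotopic both to \<open>g\<close> and to \<open>antipode \<circ> g\<close>, whose degrees are
  opposite when \<open>p\<close> is even.
\<close>

lemma degree_zero_if_never_parallel:
  assumes f: "continuous_map (nsphere p) (nsphere p) f"
    and g: "continuous_map (nsphere p) (nsphere p) g"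
    and neq: "\<And>x. x \<in> topspace (nsphere p) \<Longrightarrow> f x \<noteq> g x"
      "\<And>x. x \<in> topspace (nsphere p) \<Longrightarrow> f x \<noteq> antipode (g x)"
    and "even p"
  shows "Brouwer_degree2 p f = 0"
proof -
  have "Brouwer_degree2 p f = Brouwer_degree2 p g"
    by (intro Brouwer_degree2_homotopic homotopic_nsphere_maps f g neq)
  moreover have "Brouwer_degree2 p f = Brouwer_degree2 p (antipode \<circ> g)"
    by (intro Brouwer_degree2_homotopic homotopic_nsphere_maps continuous_map_compose [OF g]
          f continuous_map_antipode) (use neq in auto)
  moreover have "Brouwer_degree2 p (antipode \<circ> g) = - Brouwer_degree2 p g"
    using \<open>even p\<close> by (simp add: Brouwer_degree2_compose [OF g continuous_map_antipode]
        Brouwer_degree2_antipode)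
  ultimately show ?thesis
    by simp
qed

section \<open>Splitting over the sphere\<close>

lemma compact_nsphere: "compact (topspace (nsphere p))"
proof -
  have "compactin (powertop_real UNIV) (\<Pi>\<^sub>E i\<in>UNIV. {-1..1})"
    by (simp add: compactin_PiE)
  then have "compact (\<Pi>\<^sub>E i\<in>(UNIV :: nat set). {-1..1::real})"
    by (simp add: euclidean_product_topology)
  moreover have "closed (topspace (nsphere p))"
    unfolding topspace_nsphere
    by (intro closed_Collect_conj closed_Collect_all closed_Collect_imp closed_Collect_eq
          open_Collect_const continuous_intros continuous_on_product_coordinates)
  moreover have "topspace (nsphere p) \<subseteq> (\<Pi>\<^sub>E i\<in>UNIV. {-1..1})"
  proof
    fix x assume x: "x \<in> topspace (nsphere p)"
    have "(x i)\<^sup>2 \<le> 1" for i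
    proof (cases "i \<le> p")
      case True
      then have "(x i)\<^sup>2 \<le> (\<Sum>j\<le>p. (x j)\<^sup>2)"
        by (intro member_le_sum) auto
      then show ?thesis using x by (simp add: topspace_nsphere)
    qed (use x in \<open>simp add: topspace_nsphere\<close>)
    then show "x \<in> (\<Pi>\<^sub>E i\<in>UNIV. {-1..1})"
      by (auto simp: abs_square_le_1 abs_le_iff)
  qed
  ultimately show ?thesis
    by (metis compact_Int_closed inf.absorb2)
qed

lemma contractible_hemispheres:
  assumes "k \<le> p"
  shows "contractible (topspace (nsphere p) \<inter> {x. x k \<ge> 0})"
    and "contractible (topspace (nsphere p) \<inter> {x. x k \<le> 0})"
proof -
  have eq: "subtopology (nsphere p) T = top_of_set (topspace (nsphere p) \<inter> T)" for T
    by (subst nsphere_eq_top_of_set) (simp add: subtopology_subtopology)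
  show "contractible (topspace (nsphere p) \<inter> {x. x k \<ge> 0})"
    using contractible_space_upper_hemisphere [OF assms] by (simp only: eq contractible_space_top_of_set)
  show "contractible (topspace (nsphere p) \<inter> {x. x k \<le> 0})"
    using contractible_space_lower_hemisphere [OF assms] by (simp only: eq contractible_space_top_of_set)
qed

text \<open>
  The hemispheres in coordinate \<open>1\<close> are contractible and share the unit vector of coordinate \<open>0\<close>.
\<close>

lemma connected_nsphere:
  assumes "p \<ge> 1"
  shows "connected (topspace (nsphere p))"
proof -
  let ?A = "topspace (nsphere p) \<inter> {x. x 1 \<ge> 0}" and ?B = "topspace (nsphere p) \<inter> {x. x 1 \<le> 0}"
  have conn: "connected_space (top_of_set ?A)" "connected_space (top_of_set ?B)"
    using contractible_hemispheres [OF assms] 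
    by (auto intro!: contractible_imp_connected_space)
  have "connected (?A \<union> ?B)"
  proof (rule connected_Un)
    show "connected ?A" "connected ?B"
      using conn unfolding connectedin_iff_connected [symmetric] connectedin_def
      by (simp_all only: topspace_euclidean subset_UNIV simp_thms)
    have "(\<lambda>i. if i = 0 then 1 else 0) \<in> ?A \<inter> ?B"
      using in_topspace_nsphere [of p] by simp
    then show "?A \<inter> ?B \<noteq> {}"
      by blast
  qed
  moreover have "?A \<union> ?B = topspace (nsphere p)"
    by auto
  ultimately show ?thesis
    by simp
qed

text \<open>
  The two hemispheres in the last coordinate meet in the sphere of dimension \<open>p - 1\<close>; it is for the
  connectedness of this equator that \<open>p \<ge> 2\<close> is required.
\<close>

lemma nsphere_selection:
  assumes "finite_valued_multimap (topspace (nsphere p)) \<psi> N" and "p \<ge> 2"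
    and a: "a \<in> topspace (nsphere (p - 1))" "y \<in> \<psi> a"
  obtains s where "continuous_on (topspace (nsphere p)) s"
    "\<And>x. x \<in> topspace (nsphere p) \<Longrightarrow> s x \<in> \<psi> x" "s a = y"
proof -
  interpret finite_valued_multimap "topspace (nsphere p)" \<psi> N by fact
  let ?A = "topspace (nsphere p) \<inter> {x. x p \<ge> 0}" and ?B = "topspace (nsphere p) \<inter> {x. x p \<le> 0}"
  obtain p' where p': "p = Suc p'" "p' \<ge> 1"
    using \<open>p \<ge> 2\<close> by (cases p) auto
  have "?A \<inter> ?B = topspace (subtopology (nsphere (Suc p')) {x. x (Suc p') = 0})"
    using p' by auto
  then have equator: "?A \<inter> ?B = topspace (nsphere p')"
    by (simp only: subtopology_nsphere_equator)
  have "closed ?A" "closed ?B"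
    by (intro closed_Int compact_imp_closed [OF compact_nsphere] closed_Collect_le
          continuous_intros continuous_on_product_coordinates)+
  moreover have "connected (?A \<inter> ?B)"
    unfolding equator by (intro connected_nsphere p')
  moreover have "topspace (nsphere p) = ?A \<union> ?B" "a \<in> ?A \<inter> ?B"
    using a(1) p' unfolding equator by auto
  ultimately show thesis
    using selection_on_union [of ?A ?B a y] contractible_hemispheres [of p p] a(2) that by blast
qed


section \<open>Multifunctions of projective spaces lifted to spheres\<close>

lemma antipodal_class_eq: "antipodal_class x = {x, antipode x}"
  by (simp add: antipodal_class_def antipode_def)

lemma antipodal_class_eq_iff: "antipodal_class x = antipodal_class y \<longleftrightarrow> x = y \<or> x = antipode y"
  by (auto simp: antipodal_class_eq doubleton_eq_iff)

lemma antipodal_class_eq_of_mem: "y \<in> antipodal_class x \<Longrightarrow> antipodal_class y = antipodal_class x"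
  by (auto simp: antipodal_class_eq)

lemma mem_antipodal_classes_iff:
  assumes "C \<subseteq> antipodal_class ` topspace (nsphere p)"
  shows "y \<in> \<Union>C \<longleftrightarrow> antipodal_class y \<in> C"
proof
  assume "y \<in> \<Union>C"
  then obtain x where "antipodal_class x \<in> C" "y \<in> antipodal_class x"
    using assms by blast
  then show "antipodal_class y \<in> C"
    using antipodal_class_eq_of_mem by metis
qed (auto simp: antipodal_class_eq)

lemma finite_card_Union_antipodal_classes:
  assumes "C \<subseteq> antipodal_class ` topspace (nsphere p)" "finite C"
  shows "finite (\<Union>C)" "card (\<Union>C) = 2 * card C"
proof -
  have fin: "finite c" "card c = 2" if "c \<in> C" for c
  proof -
    obtain x where "x \<in> topspace (nsphere p)" "c = {x, antipode x}"
      using \<open>c \<in> C\<close> assms(1) antipodal_class_eq by blast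
    then show "finite c" "card c = 2"
      using antipode_neq [of x p] by auto
  qed
  have "disjnt c d" if "c \<in> C" "d \<in> C" "c \<noteq> d" for c d
  proof -
    obtain x y where "c = antipodal_class x" "d = antipodal_class y"
      using \<open>c \<in> C\<close> \<open>d \<in> C\<close> assms(1) by blast
    then have "antipodal_class z = c" "antipodal_class w = d" if "z \<in> c" "w \<in> d" for z w
      using that antipodal_class_eq_of_mem by blast+
    then show ?thesis
      using \<open>c \<noteq> d\<close> unfolding disjnt_iff by blast
  qed
  then have "card (\<Union>C) = (\<Sum>c\<in>C. card c)"
    using fin by (intro card_Union_disjoint) (auto simp: pairwise_def)
  then show "card (\<Union>C) = 2 * card C"
    using fin by simp
  show "finite (\<Union>C)"
    using fin assms(2) by blast
qed

lemma topspace_real_projective_space: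
  "topspace (real_projective_space p) = antipodal_class ` topspace (nsphere p)"
  by (simp add: real_projective_space_def topspace_quotient_topology)

lemma openin_real_projective_space:
  "openin (real_projective_space p) U \<longleftrightarrow> U \<subseteq> antipodal_class ` topspace (nsphere p) \<and>
     openin (nsphere p) {x \<in> topspace (nsphere p). antipodal_class x \<in> U}"
  by (simp add: real_projective_space_def openin_quotient_topology)

lemma openin_antipodal_class_image:
  assumes "openin (nsphere p) V"
  shows "openin (real_projective_space p) (antipodal_class ` V)"
proof -
  have V: "V \<subseteq> topspace (nsphere p)"
    using assms by (rule openin_subset)
  have "{x \<in> topspace (nsphere p). antipodal_class x \<in> antipodal_class ` V} =
        V \<union> {x \<in> topspace (nsphere p). antipode x \<in> V}"
  proof -
    have "antipodal_class x \<in> antipodal_class ` V \<longleftrightarrow> x \<in> V \<or> antipode x \<in> V" for x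
    proof
      assume "x \<in> V \<or> antipode x \<in> V"
      moreover have "antipodal_class x = antipodal_class (antipode x)"
        by (simp add: antipodal_class_eq_iff)
      ultimately show "antipodal_class x \<in> antipodal_class ` V"
        by blast
    qed (auto simp: antipodal_class_eq_iff)
    then show ?thesis
      using V by blast
  qed
  moreover have "openin (nsphere p) \<dots>"
    using assms by (intro openin_Un openin_continuous_map_preimage [OF continuous_map_antipode])
  ultimately show ?thesis
    using V by (auto simp: openin_real_projective_space)
qed

text \<open>
  Lower semicontinuity passes to the lift because the projection is both continuous and open.
\<close>

lemma finite_valued_multimap_lift:
  assumes "n_valued_map n (real_projective_space p) (real_projective_space p) \<phi>"
  shows "finite_valued_multimap (topspace (nsphere p)) (\<lambda>x. \<Union>(\<phi> (antipodal_class x))) (2 * n)"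
proof
  let ?S = "topspace (nsphere p)" and ?q = antipodal_class
  have sub: "\<phi> (?q x) \<subseteq> ?q ` ?S" and fin: "finite (\<phi> (?q x))" and card: "card (\<phi> (?q x)) = n"
    if "x \<in> ?S" for x
    using assms that
    by (auto simp: n_valued_map_def continuous_multifunction_def multifunction_def
        topspace_real_projective_space)
  show "compact ?S"
    by (rule compact_nsphere)
  show "finite (\<Union>(\<phi> (?q x)))" "card (\<Union>(\<phi> (?q x))) = 2 * n" if "x \<in> ?S" for x
    using finite_card_Union_antipodal_classes [OF sub fin] card that by auto
  fix V :: "(nat \<Rightarrow> real) set" assume "open V"
  then have "openin (nsphere p) (?S \<inter> V)"
    by (subst nsphere_eq_top_of_set) (simp add: openin_open_Int)
  then have "openin (real_projective_space p)
      {c \<in> topspace (real_projective_space p). \<phi> c \<inter> ?q ` (?S \<inter> V) \<noteq> {}}"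
    using assms openin_antipodal_class_image
    by (auto simp: n_valued_map_def continuous_multifunction_def lower_semicontinuous_multi_def)
  then have "openin (nsphere p) {x \<in> ?S. \<phi> (?q x) \<inter> ?q ` (?S \<inter> V) \<noteq> {}}"
    by (simp add: openin_real_projective_space topspace_real_projective_space cong: conj_cong)
  moreover have "\<phi> (?q x) \<inter> ?q ` (?S \<inter> V) \<noteq> {} \<longleftrightarrow> \<Union>(\<phi> (?q x)) \<inter> V \<noteq> {}" if "x \<in> ?S" for x
  proof -
    have "\<Union>(\<phi> (?q x)) \<subseteq> ?S"
      using sub [OF that] by (auto simp: antipodal_class_eq)
    then show ?thesis
      using mem_antipodal_classes_iff [OF sub [OF that]] by blast
  qed
  ultimately show "openin (top_of_set ?S) {x \<in> ?S. \<Union>(\<phi> (?q x)) \<inter> V \<noteq> {}}"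
    by (subst nsphere_eq_top_of_set [symmetric]) (simp cong: conj_cong)
qed

text \<open>
  Over the base point \<open>a\<close>, which lies on the equator, each of the \<open>2 * n\<close> points \<open>y\<close> of the lifted
  value starts a selection \<open>s y\<close>. Different selections never meet, so in the second claim the fixed
  points that the degree provides for each \<open>s y\<close> are pairwise different.
\<close>

lemma lifted_fixed_points:
  assumes "n_valued_map n (real_projective_space p) (real_projective_space p) \<phi>"
    and even: "even p" and p: "p \<ge> 2" and n: "n \<ge> 1"
    and F: "F = {x \<in> topspace (nsphere p). x \<in> \<Union>(\<phi> (antipodal_class x))}" "finite F"
  shows "F \<noteq> {}" and "n \<ge> 2 \<Longrightarrow> 2 * n \<le> card F"
proof -
  let ?S = "topspace (nsphere p)"
  define \<psi> where "\<psi> = (\<lambda>x. \<Union>(\<phi> (antipodal_class x)))"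
  have "finite_valued_multimap ?S \<psi> (2 * n)"
    unfolding \<psi>_def by (rule finite_valued_multimap_lift) fact
  then interpret finite_valued_multimap ?S \<psi> "2 * n" .
  have classes: "\<phi> (antipodal_class x) \<subseteq> antipodal_class ` ?S" if "x \<in> ?S" for x
    using assms(1) that
    by (auto simp: n_valued_map_def continuous_multifunction_def multifunction_def
        topspace_real_projective_space)
  have \<psi>S: "\<psi> x \<subseteq> ?S" if "x \<in> ?S" for x
    using classes [OF that] by (auto simp: \<psi>_def antipodal_class_eq)
  have \<psi>_antipode: "antipode y \<in> \<psi> x" if "x \<in> ?S" "y \<in> \<psi> x" for x y
  proof -
    have "antipodal_class (antipode y) = antipodal_class y"
      by (auto simp: antipodal_class_eq)
    then show ?thesis
      using that mem_antipodal_classes_iff [OF classes [OF that(1)]] by (simp add: \<psi>_def)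
  qed
  define a :: "nat \<Rightarrow> real" where "a = (\<lambda>i. if i = 0 then 1 else 0)"
  have a: "a \<in> topspace (nsphere q)" for q
    unfolding a_def by (rule in_topspace_nsphere)
  have "\<exists>s. continuous_on ?S s \<and> (\<forall>x\<in>?S. s x \<in> \<psi> x) \<and> s a = y" if y: "y \<in> \<psi> a" for y
    by (rule nsphere_selection [OF finite_valued_multimap_axioms p a y]) blast
  then obtain s where s: "\<And>y. y \<in> \<psi> a \<Longrightarrow> continuous_on ?S (s y)"
      "\<And>y x. y \<in> \<psi> a \<Longrightarrow> x \<in> ?S \<Longrightarrow> s y x \<in> \<psi> x" "\<And>y. y \<in> \<psi> a \<Longrightarrow> s y a = y"
    by metis
  have conts: "continuous_map (nsphere p) (nsphere p) (s y)" if "y \<in> \<psi> a" for y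
    unfolding continuous_map_nsphere_iff using s that \<psi>S by blast
  have contas: "continuous_map (nsphere p) (nsphere p) (antipode \<circ> s y)" if "y \<in> \<psi> a" for y
    using conts [OF that] continuous_map_antipode by (rule continuous_map_compose)
  have distinct: "f x \<noteq> g x"
    if "continuous_map (nsphere p) (nsphere p) f" "\<And>x. x \<in> ?S \<Longrightarrow> f x \<in> \<psi> x"
       "continuous_map (nsphere p) (nsphere p) g" "\<And>x. x \<in> ?S \<Longrightarrow> g x \<in> \<psi> x"
       "f a \<noteq> g a" "x \<in> ?S" for f g x
  proof
    assume "f x = g x"
    then have "f a = g a"
      using that(1-4,6) p a [of p]
      by (intro selections_agree [where C = ?S and g = id and s = f and t = g and a = x and c = a])
         (simp_all add: continuous_map_nsphere_iff connected_nsphere)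
    then show False
      using that(5) by blast
  qed
  have card_a: "card (\<psi> a) = 2 * n" "finite (\<psi> a)"
    using card_values finite_values a by auto
  show "F \<noteq> {}"
  proof -
    have "\<psi> a \<noteq> {}"
      using card_a n by auto
    then obtain y where y: "y \<in> \<psi> a"
      by blast
    have "Brouwer_degree2 p (antipode \<circ> s y) = - Brouwer_degree2 p (s y)"
      using even by (simp add: Brouwer_degree2_compose [OF conts [OF y] continuous_map_antipode]
          Brouwer_degree2_antipode)
    moreover have "(-1 :: int) ^ Suc p = -1"
      using even by simp
    ultimately consider "Brouwer_degree2 p (s y) \<noteq> (-1) ^ Suc p"
      | "Brouwer_degree2 p (antipode \<circ> s y) \<noteq> (-1) ^ Suc p"
      by linarith
    then show ?thesis
    proof cases
      case 1
      then obtain x where x: "x \<in> ?S" "s y x = x"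
        using fixed_point_if_degree_neq [OF conts [OF y]] by blast
      then have "x \<in> \<psi> x"
        using s(2) [OF y x(1)] by simp
      then show ?thesis
        using x(1) unfolding F(1) \<psi>_def by blast
    next
      case 2
      then obtain x where x: "x \<in> ?S" "antipode (s y x) = x"
        using fixed_point_if_degree_neq [OF contas [OF y]] by auto
      then have "x \<in> \<psi> x"
        using \<psi>_antipode [OF x(1) s(2) [OF y x(1)]] by simp
      then show ?thesis
        using x(1) unfolding F(1) \<psi>_def by blast
    qed
  qed
  show "2 * n \<le> card F" if "n \<ge> 2"
  proof -
    have "\<exists>x\<in>?S. s y x = x" if y: "y \<in> \<psi> a" for y
    proof -
      have "\<not> \<psi> a \<subseteq> {y, antipode y}"
      proof
        assume "\<psi> a \<subseteq> {y, antipode y}"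
        then have "card (\<psi> a) \<le> card {y, antipode y}"
          by (intro card_mono) simp_all
        also have "\<dots> \<le> 2"
          by (simp add: card_insert_if)
        finally show False
          using card_a(1) \<open>n \<ge> 2\<close> by linarith
      qed
      then obtain z where z: "z \<in> \<psi> a" "z \<noteq> y" "z \<noteq> antipode y"
        by blast
      then have "y \<noteq> antipode z"
        by auto
      have "Brouwer_degree2 p (s y) = 0"
      proof (rule degree_zero_if_never_parallel [OF conts [OF y] conts [OF z(1)] _ _ even])
        fix x assume x: "x \<in> ?S"
        show "s y x \<noteq> s z x"
        proof (rule distinct [OF conts [OF y] s(2) [OF y] conts [OF z(1)] s(2) [OF z(1)] _ x])
          show "s y a \<noteq> s z a"
            unfolding s(3) [OF y] s(3) [OF z(1)] by (rule z(2) [symmetric])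
        qed
        have "s y x \<noteq> (antipode \<circ> s z) x"
        proof (rule distinct [OF conts [OF y] s(2) [OF y] contas [OF z(1)] _ _ x])
          show "(antipode \<circ> s z) x' \<in> \<psi> x'" if "x' \<in> ?S" for x'
            using \<psi>_antipode [OF that s(2) [OF z(1) that]] by simp
          show "s y a \<noteq> (antipode \<circ> s z) a"
            unfolding o_apply s(3) [OF y] s(3) [OF z(1)] by fact
        qed
        then show "s y x \<noteq> antipode (s z x)"
          by simp
      qed
      then show ?thesis
        using fixed_point_if_degree_neq [OF conts [OF y]] by auto
    qed
    then obtain x where x: "\<And>y. y \<in> \<psi> a \<Longrightarrow> x y \<in> ?S \<and> s y (x y) = x y"
      by metis
    have "inj_on x (\<psi> a)"
    proof (rule inj_onI, rule ccontr)
      fix y z assume yz: "y \<in> \<psi> a" "z \<in> \<psi> a" "x y = x z" "y \<noteq> z"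
      have "s y (x y) \<noteq> s z (x y)"
      proof (rule distinct [OF conts [OF yz(1)] s(2) [OF yz(1)] conts [OF yz(2)] s(2) [OF yz(2)]])
        show "s y a \<noteq> s z a"
          unfolding s(3) [OF yz(1)] s(3) [OF yz(2)] by fact
        show "x y \<in> ?S"
          using x [OF yz(1)] by blast
      qed
      then show False
        using x [OF yz(1)] x [OF yz(2)] yz(3) by simp
    qed
    moreover have "x ` \<psi> a \<subseteq> F"
    proof (rule image_subsetI)
      fix y assume y: "y \<in> \<psi> a"
      then have "x y \<in> \<psi> (x y)"
        using s(2) [OF y, of "x y"] x [OF y] by simp
      then show "x y \<in> F"
        using x [OF y] unfolding F(1) \<psi>_def by blast
    qed
    ultimately show ?thesis
      using card_inj_on_le [OF _ _ F(2)] card_a(1) by fastforce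
  qed
qed

theorem theorem3:
  fixes k n :: nat
  assumes "k \<ge> 1" and "n \<ge> 1"
  shows "n_valued_fixed_point_property n (real_projective_space (2 * k)) \<and>
    (\<forall>\<phi>. n_valued_map n (real_projective_space (2 * k)) (real_projective_space (2 * k)) \<phi> \<longrightarrow>
       infinite (fixed_points_multi (real_projective_space (2 * k)) \<phi>) \<or>
       card (fixed_points_multi (real_projective_space (2 * k)) \<phi>) \<ge> n)"
proof -
  let ?P = "real_projective_space (2 * k)"
  let ?Fix = "\<lambda>\<phi>. fixed_points_multi ?P \<phi>"
  have main: "n \<le> card (?Fix \<phi>)"
    if \<phi>: "n_valued_map n ?P ?P \<phi>" and fin: "finite (?Fix \<phi>)" for \<phi>
  proof -
    let ?S = "topspace (nsphere (2 * k))"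
    have sub: "?Fix \<phi> \<subseteq> antipodal_class ` ?S"
      by (auto simp: fixed_points_multi_def topspace_real_projective_space)
    have "\<Union>(?Fix \<phi>) = {x \<in> ?S. x \<in> \<Union>(\<phi> (antipodal_class x))}"
    proof -
      have "x \<in> \<Union>(?Fix \<phi>) \<longleftrightarrow> x \<in> ?S \<and> x \<in> \<Union>(\<phi> (antipodal_class x))" for x
      proof -
        have "\<phi> (antipodal_class x) \<subseteq> antipodal_class ` ?S" if "x \<in> ?S"
          using \<phi> that by (auto simp: n_valued_map_def continuous_multifunction_def
              multifunction_def topspace_real_projective_space)
        moreover have "antipodal_class x \<in> antipodal_class ` ?S \<longleftrightarrow> x \<in> ?S"
          by (auto simp: antipodal_class_eq_iff)
        ultimately show ?thesis
          using mem_antipodal_classes_iff [OF sub, of x] mem_antipodal_classes_iff [of "\<phi> (antipodal_class x)" "2 * k" x]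
          by (auto simp: fixed_points_multi_def topspace_real_projective_space)
      qed
      then show ?thesis
        by blast
    qed
    note lifted = lifted_fixed_points [OF \<phi> _ _ _ this]
    have "finite (\<Union>(?Fix \<phi>))" "card (\<Union>(?Fix \<phi>)) = 2 * card (?Fix \<phi>)"
      using finite_card_Union_antipodal_classes [OF sub fin] by auto
    then show "n \<le> card (?Fix \<phi>)"
    proof (cases "n = 1")
      case True
      then show ?thesis
        using lifted(1) assms fin \<open>finite (\<Union>(?Fix \<phi>))\<close> by (auto simp: Suc_le_eq card_gt_0_iff)
    next
      case False
      then show ?thesis
        using lifted(2) assms \<open>finite (\<Union>(?Fix \<phi>))\<close> \<open>card (\<Union>(?Fix \<phi>)) = 2 * card (?Fix \<phi>)\<close> by auto
    qed
  qed
  moreover have "\<exists>x. x \<in> ?Fix \<phi>" if "n_valued_map n ?P ?P \<phi>" for \<phi>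
  proof (rule ccontr)
    assume "\<nexists>x. x \<in> ?Fix \<phi>"
    then have "?Fix \<phi> = {}"
      by blast
    then show False
      using main [OF that] \<open>n \<ge> 1\<close> by simp
  qed
  ultimately show ?thesis
    unfolding n_valued_fixed_point_property_def by blast
qed

end
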